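(* Let $k_1,k_2\ge 2$ be integers, and let $G_1$ and $G_2$ be graphs admitting a neighborhood-balanced $k_1$-coloring and a neighborhood-balanced $k_2$-coloring, respectively. Then the direct product $G_1\times G_2$ admits a neighborhood-balanced $k_1k_2$-coloring.
   Context: All graphs are finite, simple and undirected. For an integer $k\ge2$, a neighborhood-balanced $k$-coloring of a graph is a (not necessarily proper) vertex coloring with colors $1,\dots,k$ such that every vertex has the same number of neighbors of each of the $k$ colors. The direct product $G_1\times G_2$ has vertex set $V(G_1)\times V(G_2)$, and $(u,v)$ and $(u',v')$ are adjacent if and only if $uu'\in E(G_1)$ and $vv'\in E(G_2)$. *)

theory Defs
  imports "Graph_Theory.Pair_Digraph"
begin

text \<open>
  A finite simple undirected graph is a \<^locale>\<open>pair_graph\<close>: a finite, loop-free digraph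
  whose arc set is a symmetric relation. Each undirected edge \<open>uv\<close> is represented by the two
  arcs \<open>(u, v)\<close> and \<open>(v, u)\<close>.
\<close>

definition neighborhood :: "'a pair_pre_digraph \<Rightarrow> 'a \<Rightarrow> 'a set" where
  "neighborhood G v = {u. (v, u) \<in> parcs G}"

text \<open>The values of \<open>c\<close> outside the vertex set are irrelevant.\<close>

definition neighborhood_balanced_coloring ::
    "'a pair_pre_digraph \<Rightarrow> nat \<Rightarrow> ('a \<Rightarrow> nat) \<Rightarrow> bool" where
  "neighborhood_balanced_coloring G k c \<longleftrightarrow>
     (\<forall>v\<in>pverts G. c v \<in> {1..k}) \<and>
     (\<forall>v\<in>pverts G. \<forall>i\<in>{1..k}. \<forall>j\<in>{1..k}.
        card {u \<in> neighborhood G v. c u = i} = card {u \<in> neighborhood G v. c u = j})"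

definition admits_neighborhood_balanced_coloring :: "'a pair_pre_digraph \<Rightarrow> nat \<Rightarrow> bool" where
  "admits_neighborhood_balanced_coloring G k \<longleftrightarrow>
     (\<exists>c. neighborhood_balanced_coloring G k c)"

definition direct_product ::
    "'a pair_pre_digraph \<Rightarrow> 'b pair_pre_digraph \<Rightarrow> ('a \<times> 'b) pair_pre_digraph" where
  "direct_product G\<^sub>1 G\<^sub>2 =
     \<lparr> pverts = pverts G\<^sub>1 \<times> pverts G\<^sub>2,
       parcs = {((u, v), (u', v')) | u v u' v'. (u, u') \<in> parcs G\<^sub>1 \<and> (v, v') \<in> parcs G\<^sub>2} \<rparr>"

lemma pair_graph_direct_product:
  assumes "pair_graph G\<^sub>1" and "pair_graph G\<^sub>2"
  shows "pair_graph (direct_product G\<^sub>1 G\<^sub>2)"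
proof -
  interpret G1: pair_graph G\<^sub>1 by fact
  interpret G2: pair_graph G\<^sub>2 by fact
  let ?P = "direct_product G\<^sub>1 G\<^sub>2"
  have sub: "parcs ?P \<subseteq> pverts ?P \<times> pverts ?P"
    by (auto simp: direct_product_def dest: G1.wellformed' G2.wellformed')
  have fin: "finite (pverts ?P)"
    by (simp add: direct_product_def)
  show ?thesis
  proof unfold_locales
    show "symmetric (with_proj ?P)"
      using G1.arcs_symmetric G2.arcs_symmetric
      by (auto simp: symmetric_def sym_def direct_product_def)
    show "finite (parcs ?P)"
      using sub fin by (meson finite_SigmaI finite_subset)
    show "fst e \<noteq> snd e" if "e \<in> parcs ?P" for e
      using that by (auto simp: direct_product_def dest: G1.pair_no_loops)
  qed (use sub fin in auto)
qed

end

theory Submission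
  imports Defs
begin

text \<open>
  Colour a vertex \<open>(u, v)\<close> of the direct product by the pair \<open>(c\<^sub>1 u, c\<^sub>2 v)\<close> of the given
  colours, with the \<open>k\<^sub>1 * k\<^sub>2\<close> colour pairs renamed to \<open>1, \<dots>, k\<^sub>1 * k\<^sub>2\<close> by an arbitrary
  bijection \<open>f\<close>. The neighbourhood of \<open>(u, v)\<close> is the product of the neighbourhoods of \<open>u\<close> and
  \<open>v\<close> (\<open>neighborhood_direct_product\<close>), so the neighbours of \<open>(u, v)\<close> coloured \<open>f (a, b)\<close> form a
  product as well (\<open>color_class_direct_product\<close>): neighbours of \<open>u\<close> coloured \<open>a\<close> times
  neighbours of \<open>v\<close> coloured \<open>b\<close>. Their number is a product of one factor independent of \<open>a\<close>
  and one independent of \<open>b\<close>, hence it is the same for every colour.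
\<close>

lemma neighborhood_direct_product:
  "neighborhood (direct_product G\<^sub>1 G\<^sub>2) (u, v) = neighborhood G\<^sub>1 u \<times> neighborhood G\<^sub>2 v"
  by (auto simp: neighborhood_def direct_product_def)

lemma neighborhood_subset_pverts:
  assumes "pair_graph G"
  shows "neighborhood G v \<subseteq> pverts G"
proof -
  interpret pair_graph G by fact
  show ?thesis by (auto simp: neighborhood_def dest: wellformed')
qed

text \<open>
  Injectivity of the renaming \<open>f\<close> on the pairs of colours that occur lets a combined colour be
  read back as its two components.
\<close>

lemma color_class_direct_product:
  assumes inj: "inj_on f (A \<times> B)" and "a \<in> A" "b \<in> B"
    and "c\<^sub>1 ` neighborhood G\<^sub>1 u \<subseteq> A" "c\<^sub>2 ` neighborhood G\<^sub>2 v \<subseteq> B"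
  shows "{p \<in> neighborhood (direct_product G\<^sub>1 G\<^sub>2) (u, v). f (map_prod c\<^sub>1 c\<^sub>2 p) = f (a, b)}
    = {x \<in> neighborhood G\<^sub>1 u. c\<^sub>1 x = a} \<times> {y \<in> neighborhood G\<^sub>2 v. c\<^sub>2 y = b}"
proof -
  have "f (c\<^sub>1 x, c\<^sub>2 y) = f (a, b) \<longleftrightarrow> c\<^sub>1 x = a \<and> c\<^sub>2 y = b"
    if "x \<in> neighborhood G\<^sub>1 u" "y \<in> neighborhood G\<^sub>2 v" for x y
    using inj_on_eq_iff[OF inj, of "(c\<^sub>1 x, c\<^sub>2 y)" "(a, b)"] assms that by auto
  then show ?thesis by (auto simp: neighborhood_direct_product)
qed

lemma neighborhood_balanced_coloring_direct_product:
  assumes graphs: "pair_graph G\<^sub>1" "pair_graph G\<^sub>2"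
    and c\<^sub>1: "neighborhood_balanced_coloring G\<^sub>1 k\<^sub>1 c\<^sub>1"
    and c\<^sub>2: "neighborhood_balanced_coloring G\<^sub>2 k\<^sub>2 c\<^sub>2"
    and f: "bij_betw f ({1..k\<^sub>1} \<times> {1..k\<^sub>2}) {1..k\<^sub>1 * k\<^sub>2}"
  shows "neighborhood_balanced_coloring (direct_product G\<^sub>1 G\<^sub>2) (k\<^sub>1 * k\<^sub>2) (f \<circ> map_prod c\<^sub>1 c\<^sub>2)"
  unfolding neighborhood_balanced_coloring_def
proof (intro conjI ballI)
  let ?P = "direct_product G\<^sub>1 G\<^sub>2"
  let ?c = "f \<circ> map_prod c\<^sub>1 c\<^sub>2"
  have range\<^sub>1: "c\<^sub>1 ` pverts G\<^sub>1 \<subseteq> {1..k\<^sub>1}" and range\<^sub>2: "c\<^sub>2 ` pverts G\<^sub>2 \<subseteq> {1..k\<^sub>2}"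
    using c\<^sub>1 c\<^sub>2 unfolding neighborhood_balanced_coloring_def by blast+
  fix p assume "p \<in> pverts ?P"
  then obtain u v where p: "p = (u, v)" and u: "u \<in> pverts G\<^sub>1" and v: "v \<in> pverts G\<^sub>2"
    by (auto simp: direct_product_def)
  have "map_prod c\<^sub>1 c\<^sub>2 p \<in> {1..k\<^sub>1} \<times> {1..k\<^sub>2}"
    unfolding p map_prod_simp using range\<^sub>1 range\<^sub>2 u v by blast
  then show "?c p \<in> {1..k\<^sub>1 * k\<^sub>2}"
    unfolding comp_apply by (rule bspec[OF bij_betwE[OF f]])
  fix i j assume "i \<in> {1..k\<^sub>1 * k\<^sub>2}" "j \<in> {1..k\<^sub>1 * k\<^sub>2}"
  then have "i \<in> f ` ({1..k\<^sub>1} \<times> {1..k\<^sub>2})" "j \<in> f ` ({1..k\<^sub>1} \<times> {1..k\<^sub>2})"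
    using bij_betw_imp_surj_on[OF f] by simp_all
  then obtain a b a' b' where i: "i = f (a, b)" and j: "j = f (a', b')"
    and ab: "a \<in> {1..k\<^sub>1}" "b \<in> {1..k\<^sub>2}" "a' \<in> {1..k\<^sub>1}" "b' \<in> {1..k\<^sub>2}"
    by (elim imageE SigmaE) simp
  have count: "card {q \<in> neighborhood ?P p. ?c q = f (x, y)}
      = card {w \<in> neighborhood G\<^sub>1 u. c\<^sub>1 w = x} * card {w \<in> neighborhood G\<^sub>2 v. c\<^sub>2 w = y}"
    if "x \<in> {1..k\<^sub>1}" "y \<in> {1..k\<^sub>2}" for x y
  proof -
    have "c\<^sub>1 ` neighborhood G\<^sub>1 u \<subseteq> {1..k\<^sub>1}" "c\<^sub>2 ` neighborhood G\<^sub>2 v \<subseteq> {1..k\<^sub>2}"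
      using image_mono[OF neighborhood_subset_pverts[OF graphs(1)]] range\<^sub>1
        image_mono[OF neighborhood_subset_pverts[OF graphs(2)]] range\<^sub>2
      by (meson order_trans)+
    from color_class_direct_product[OF bij_betw_imp_inj_on[OF f] that this]
    show ?thesis by (simp add: p card_cartesian_product)
  qed
  have "card {w \<in> neighborhood G\<^sub>1 u. c\<^sub>1 w = a} = card {w \<in> neighborhood G\<^sub>1 u. c\<^sub>1 w = a'}"
    using c\<^sub>1 u ab(1,3) unfolding neighborhood_balanced_coloring_def by meson
  moreover have
    "card {w \<in> neighborhood G\<^sub>2 v. c\<^sub>2 w = b} = card {w \<in> neighborhood G\<^sub>2 v. c\<^sub>2 w = b'}"
    using c\<^sub>2 v ab(2,4) unfolding neighborhood_balanced_coloring_def by meson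
  ultimately show
    "card {q \<in> neighborhood ?P p. ?c q = i} = card {q \<in> neighborhood ?P p. ?c q = j}"
    unfolding i j count[OF ab(1,2)] count[OF ab(3,4)] by simp
qed

theorem theorem3p15:
  fixes G\<^sub>1 :: "'a pair_pre_digraph" and G\<^sub>2 :: "'b pair_pre_digraph" and k\<^sub>1 k\<^sub>2 :: nat
  assumes "k\<^sub>1 \<ge> 2" and "k\<^sub>2 \<ge> 2"
    and "pair_graph G\<^sub>1" and "pair_graph G\<^sub>2"
    and "admits_neighborhood_balanced_coloring G\<^sub>1 k\<^sub>1"
    and "admits_neighborhood_balanced_coloring G\<^sub>2 k\<^sub>2"
  shows "admits_neighborhood_balanced_coloring (direct_product G\<^sub>1 G\<^sub>2) (k\<^sub>1 * k\<^sub>2)"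
proof -
  obtain c\<^sub>1 c\<^sub>2 where c\<^sub>1: "neighborhood_balanced_coloring G\<^sub>1 k\<^sub>1 c\<^sub>1"
    and c\<^sub>2: "neighborhood_balanced_coloring G\<^sub>2 k\<^sub>2 c\<^sub>2"
    using assms(5,6) unfolding admits_neighborhood_balanced_coloring_def by (elim exE)
  have "card ({1..k\<^sub>1} \<times> {1..k\<^sub>2}) = card {1..k\<^sub>1 * k\<^sub>2}"
    by (simp add: card_cartesian_product)
  then obtain f where f: "bij_betw f ({1..k\<^sub>1} \<times> {1..k\<^sub>2}) {1..k\<^sub>1 * k\<^sub>2}"
    using finite_same_card_bij[of "{1..k\<^sub>1} \<times> {1..k\<^sub>2}" "{1..k\<^sub>1 * k\<^sub>2}"] by auto
  from neighborhood_balanced_coloring_direct_product[OF assms(3,4) c\<^sub>1 c\<^sub>2 f] show ?thesis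
    unfolding admits_neighborhood_balanced_coloring_def by blast
qed

end
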